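(* Let $f\in C^{0,2}(\Omega\times\mathbb{R},\mathbb{R})$ be $(\mathrm{DC})$, let $\tau$ be the local skewproduct flow defined by $x'=f(\omega\cdot t,x)$, $\omega\in\Omega$, let $m\in\mathfrak{M}_{\mathrm{erg}}(\Omega,\sigma)$, let $\mathcal{K}\subset\Omega\times\mathbb{R}$ be a compact $\tau$-invariant set projecting onto $\Omega$ with variation interval $J_{\mathcal{K}}$, and let $\beta_\nu,\beta_\mu:\Omega\to\mathbb{R}$ be two different (i.e., not $m$-a.e. equal) $m$-measurable $\tau$-equilibria with graphs contained in $\mathcal{K}$. Then $$\int_\Omega f_x(\omega,\beta_\nu(\omega))\,dm+\int_\Omega f_x(\omega,\beta_\mu(\omega))\,dm\le 0.$$ In addition, the previous inequality is strict in any of the following cases: (i) if $f$ is $(\mathrm{SDC})_m$ on the variation interval $J_{\mathcal{K}}$ of $\mathcal{K}$; (ii) if the graphs of $\beta_\nu$ and $\beta_\mu$ are contained in disjoint compact $\tau$-invariant subsets of $\mathcal{K}$ and if, in addition, $f$ is $(\mathrm{SDC})$ or, more generally, if $m(\{\omega\in\Omega: b_{J_{\mathcal{K}},\epsilon}(\omega)>0\})>0$ for every $\epsilon\in(0,l(J_{\mathcal{K}})/2]$.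
   Context: $\Omega$ is a compact metric space with a continuous flow $\sigma:\mathbb{R}\times\Omega\to\Omega$, written $\sigma(t,\omega)=\omega\cdot t$. $C^{0,k}(\Omega\times\mathbb{R},\mathbb{R})$ is the set of functions $f:\Omega\times\mathbb{R}\to\mathbb{R}$ such that $f$ and its partial derivatives with respect to $x$ up to order $k$ exist and are jointly continuous. $t\mapsto u(t,\omega,x_0)$ is the maximal solution of $x'=f(\omega\cdot t,x)$ with $u(0,\omega,x_0)=x_0$; the local skewproduct flow is $\tau(t,\omega,x_0)=(\omega\cdot t,u(t,\omega,x_0))$. A set is $\tau$-invariant if it is composed of globally defined $\tau$-orbits. A compact $\tau$-invariant set $\mathcal{K}$ projects onto $\Omega$ if $(\omega,x)\mapsto\omega$ maps $\mathcal{K}$ onto $\Omega$. Its variation interval is $J_{\mathcal{K}}=[\inf_{(\omega,x)\in\mathcal{K}}x,\ \sup_{(\omega,x)\in\mathcal{K}}x]$. A $\tau$-equilibrium is a map $\beta:\Omega\to\mathbb{R}$ with $\beta(\omega\cdot t)=u(t,\omega,\beta(\omega))$ for all $\omega\in\Omega$, $t\in\mathbb{R}$; it is $m$-measurable if it is measurable for the $m$-completion of the Borel $\sigma$-algebra. $\mathfrak{M}_{\mathrm{erg}}(\Omega,\sigma)$ is the set of normalized $\sigma$-ergodic Borel measures on $\Omega$. $f$ is $(\mathrm{DC})$ if $f_x(\omega,\cdot)$ is concave on $\mathbb{R}$ for all $\omega$. For a (DC) function $f$, a compact nondegenerate interval $J$ of length $l(J)$ and $\epsilon\in[0,l(J)]$,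 $$b_{J,\epsilon}(\omega)=\frac{\epsilon}{4\,l(J)^2}\min_{x\in J_\epsilon}\{2f_x(\omega,x)-f_x(\omega,x-\epsilon/2)-f_x(\omega,x+\epsilon/2)\},\quad J_\epsilon=\{x\in\mathbb{R}:[x-\epsilon/2,x+\epsilon/2]\subseteq J\}.$$ $f$ is $(\mathrm{SDC})_m$ on $J$ if it is (DC) and there exists $\rho>0$ such that $m(\{\omega: b_{J,\epsilon}(\omega)>0\})>\rho$ for all $\epsilon\in(0,l(J)/2]$. $f$ is $(\mathrm{SDC})$ on $J$ if it is (DC) and $m'(\{\omega: b_{J,\epsilon}(\omega)>0\})>0$ for every $\epsilon\in(0,l(J)/2]$ and every $m'\in\mathfrak{M}_{\mathrm{erg}}(\Omega,\sigma)$; $f$ is $(\mathrm{SDC})$ if it is $(\mathrm{SDC})$ on every compact (nondegenerate) interval $J$. *)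

theory Defs
  imports "HOL-Probability.Probability"
begin

text \<open>
  The base space \<open>\<Omega>\<close> is a type \<open>'w\<close> whose universe is compact. A flow is curried,
  \<open>\<sigma> t \<omega> = \<omega>\<cdot>t\<close>, and so is the vector field, \<open>f \<omega> x\<close>.
\<close>

definition continuous_flow :: "(real \<Rightarrow> 'w::metric_space \<Rightarrow> 'w) \<Rightarrow> bool" where
  "continuous_flow \<sigma> \<longleftrightarrow>
     (\<forall>\<omega>. \<sigma> 0 \<omega> = \<omega>) \<and>
     (\<forall>s t \<omega>. \<sigma> (s + t) \<omega> = \<sigma> s (\<sigma> t \<omega>)) \<and>
     continuous_on UNIV (\<lambda>(t, \<omega>). \<sigma> t \<omega>)"

definition C0k :: "nat \<Rightarrow> ('w::metric_space \<Rightarrow> real \<Rightarrow> real) \<Rightarrow> bool" where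
  "C0k k f \<longleftrightarrow>
     (\<forall>i<k. \<forall>\<omega> x. (deriv ^^ i) (f \<omega>) field_differentiable (at x)) \<and>
     (\<forall>i\<le>k. continuous_on UNIV (\<lambda>(\<omega>, x). (deriv ^^ i) (f \<omega>) x))"

abbreviation f_x :: "('w \<Rightarrow> real \<Rightarrow> real) \<Rightarrow> 'w \<Rightarrow> real \<Rightarrow> real" where
  "f_x f \<omega> x \<equiv> deriv (f \<omega>) x"

definition is_solution ::
  "(real \<Rightarrow> 'w \<Rightarrow> 'w) \<Rightarrow> ('w \<Rightarrow> real \<Rightarrow> real) \<Rightarrow> 'w \<Rightarrow> real \<Rightarrow> real set \<Rightarrow> (real \<Rightarrow> real) \<Rightarrow> bool" where
  "is_solution \<sigma> f \<omega> x0 I v \<longleftrightarrow>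
     open I \<and> is_interval I \<and> 0 \<in> I \<and> v 0 = x0 \<and>
     (\<forall>t\<in>I. (v has_real_derivative f (\<sigma> t \<omega>) (v t)) (at t))"

definition max_interval ::
  "(real \<Rightarrow> 'w \<Rightarrow> 'w) \<Rightarrow> ('w \<Rightarrow> real \<Rightarrow> real) \<Rightarrow> 'w \<Rightarrow> real \<Rightarrow> real set" where
  "max_interval \<sigma> f \<omega> x0 = \<Union>{I. \<exists>v. is_solution \<sigma> f \<omega> x0 I v}"

text \<open>
  The maximal solution \<open>u(t, \<omega>, x0)\<close>: all local solutions are glued together. The value is well
  defined for \<open>t \<in> max_interval \<sigma> f \<omega> x0\<close> when solutions are unique (for instance if
  \<open>f\<close> satisfies \<open>C0k 1\<close>), and it is meaningless for other \<open>t\<close>.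
\<close>

definition max_solution ::
  "(real \<Rightarrow> 'w \<Rightarrow> 'w) \<Rightarrow> ('w \<Rightarrow> real \<Rightarrow> real) \<Rightarrow> real \<Rightarrow> 'w \<Rightarrow> real \<Rightarrow> real" where
  "max_solution \<sigma> f t \<omega> x0 = (THE y. \<exists>I v. is_solution \<sigma> f \<omega> x0 I v \<and> t \<in> I \<and> v t = y)"

definition skewproduct ::
  "(real \<Rightarrow> 'w \<Rightarrow> 'w) \<Rightarrow> ('w \<Rightarrow> real \<Rightarrow> real) \<Rightarrow> real \<Rightarrow> 'w \<times> real \<Rightarrow> 'w \<times> real" where
  "skewproduct \<sigma> f t = (\<lambda>(\<omega>, x). (\<sigma> t \<omega>, max_solution \<sigma> f t \<omega> x))"

definition tau_invariant ::
  "(real \<Rightarrow> 'w \<Rightarrow> 'w) \<Rightarrow> ('w \<Rightarrow> real \<Rightarrow> real) \<Rightarrow> ('w \<times> real) set \<Rightarrow> bool" where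
  "tau_invariant \<sigma> f K \<longleftrightarrow>
     (\<forall>(\<omega>, x)\<in>K. max_interval \<sigma> f \<omega> x = UNIV \<and> (\<forall>t. skewproduct \<sigma> f t (\<omega>, x) \<in> K))"

definition tau_equilibrium ::
  "(real \<Rightarrow> 'w \<Rightarrow> 'w) \<Rightarrow> ('w \<Rightarrow> real \<Rightarrow> real) \<Rightarrow> ('w \<Rightarrow> real) \<Rightarrow> bool" where
  "tau_equilibrium \<sigma> f \<beta> \<longleftrightarrow>
     (\<forall>\<omega> t. t \<in> max_interval \<sigma> f \<omega> (\<beta> \<omega>) \<and> \<beta> (\<sigma> t \<omega>) = max_solution \<sigma> f t \<omega> (\<beta> \<omega>))"

definition graph_of :: "('w \<Rightarrow> real) \<Rightarrow> ('w \<times> real) set" where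
  "graph_of \<beta> = range (\<lambda>\<omega>. (\<omega>, \<beta> \<omega>))"

definition variation_interval :: "('w \<times> real) set \<Rightarrow> real set" where
  "variation_interval K = {Inf (snd ` K)..Sup (snd ` K)}"

definition erg_measures :: "(real \<Rightarrow> 'w::metric_space \<Rightarrow> 'w) \<Rightarrow> 'w measure set" where
  "erg_measures \<sigma> =
     {m. sets m = sets borel \<and> prob_space m \<and>
         (\<forall>t. \<forall>A\<in>sets borel. emeasure m (\<sigma> t ` A) = emeasure m A) \<and>
         (\<forall>A\<in>sets borel. (\<forall>t. \<sigma> t ` A = A) \<longrightarrow> emeasure m A = 0 \<or> emeasure m A = 1)}"

definition DC :: "('w \<Rightarrow> real \<Rightarrow> real) \<Rightarrow> bool" where
  "DC f \<longleftrightarrow> (\<forall>\<omega>. concave_on UNIV (f_x f \<omega>))"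

definition interval_length :: "real set \<Rightarrow> real" where
  "interval_length J = Sup J - Inf J"

definition inner_interval :: "real set \<Rightarrow> real \<Rightarrow> real set" where
  "inner_interval J \<epsilon> = {x. {x - \<epsilon>/2..x + \<epsilon>/2} \<subseteq> J}"

text \<open>
  The infimum below is a minimum whenever \<open>f_x\<close> is continuous in \<open>x\<close>, \<open>J\<close> is a compact interval
  and \<open>0 \<le> \<epsilon> \<le> interval_length J\<close>, as \<open>inner_interval J \<epsilon>\<close> is then compact and nonempty.
\<close>

definition b_fun :: "('w \<Rightarrow> real \<Rightarrow> real) \<Rightarrow> real set \<Rightarrow> real \<Rightarrow> 'w \<Rightarrow> real" where
  "b_fun f J \<epsilon> \<omega> = \<epsilon> / (4 * (interval_length J)\<^sup>2) *
     (INF x\<in>inner_interval J \<epsilon>. 2 * f_x f \<omega> x - f_x f \<omega> (x - \<epsilon>/2) - f_x f \<omega> (x + \<epsilon>/2))"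

definition SDC_wrt :: "'w measure \<Rightarrow> ('w \<Rightarrow> real \<Rightarrow> real) \<Rightarrow> real set \<Rightarrow> bool" where
  "SDC_wrt m f J \<longleftrightarrow>
     DC f \<and> (\<exists>\<rho>>0. \<forall>\<epsilon>\<in>{0<..interval_length J / 2}. measure m {\<omega>. b_fun f J \<epsilon> \<omega> > 0} > \<rho>)"

definition SDC_on ::
  "(real \<Rightarrow> 'w::metric_space \<Rightarrow> 'w) \<Rightarrow> ('w \<Rightarrow> real \<Rightarrow> real) \<Rightarrow> real set \<Rightarrow> bool" where
  "SDC_on \<sigma> f J \<longleftrightarrow>
     DC f \<and> (\<forall>\<epsilon>\<in>{0<..interval_length J / 2}. \<forall>m'\<in>erg_measures \<sigma>. measure m' {\<omega>. b_fun f J \<epsilon> \<omega> > 0} > 0)"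

definition SDC :: "(real \<Rightarrow> 'w::metric_space \<Rightarrow> 'w) \<Rightarrow> ('w \<Rightarrow> real \<Rightarrow> real) \<Rightarrow> bool" where
  "SDC \<sigma> f \<longleftrightarrow> (\<forall>p q. p < q \<longrightarrow> SDC_on \<sigma> f {p..q})"

end

theory Submission
  imports Defs
begin

text \<open>
  Along an orbit the separation \<open>D = \<beta>\<^sub>\<nu> - \<beta>\<^sub>\<mu>\<close> of two equilibria satisfies the linear equation
  \<open>D' = F D\<close>, where \<open>F\<close> is the difference quotient of \<open>f \<omega>\<close> between the two equilibria. A
  Gronwall estimate (\<open>exponential_comparison\<close>) shows that the set where they differ is invariant;
  as it is not null, ergodicity makes it of full measure (\<open>ergodic_invariant_set_completion\<close>).
  There \<open>F\<close> is the derivative along the flow of \<open>h = ln \<bar>\<beta>\<^sub>\<nu> - \<beta>\<^sub>\<mu>\<bar>\<close>, and the increments of \<open>h\<close> over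
  time \<open>t\<close> are bounded by \<open>L \<bar>t\<bar>\<close>. Hence \<open>F\<close> has zero mean (\<open>integral_flow_derivative_eq_0\<close>).
  The function \<open>h\<close> itself may fail to be integrable, and the argument avoids this by truncation
  (\<open>integral_coboundary_eq_0\<close>).

  On the other hand, \<open>F \<omega>\<close> is the average of the concave function \<open>f_x f \<omega>\<close> over the interval
  between the two equilibria, so the Hermite--Hadamard inequality
  (\<open>hermite_hadamard_concave\<close>, \<open>difference_quotient_ge_mean\<close>) gives
  \<open>f_x f \<omega> (\<beta>\<^sub>\<nu> \<omega>) + f_x f \<omega> (\<beta>\<^sub>\<mu> \<omega>) \<le> 2 F \<omega>\<close>. Integrating yields the inequality.

  Equality in the mean forces equality for almost every \<open>\<omega>\<close>, and then \<open>f_x f \<omega>\<close> is affine between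
  the equilibria. This excludes \<open>b_fun f J \<epsilon> \<omega> > 0\<close> as soon as the equilibria are at least \<open>\<epsilon>\<close>
  apart. So \<open>b_fun f J \<epsilon>\<close> can be positive, up to a null set, only where they are \<open>\<epsilon>\<close>-close.
  The measure of this set tends to \<open>0\<close> with \<open>\<epsilon>\<close>, which contradicts the uniform lower bound in the
  first case of strictness; and the set is empty for small \<open>\<epsilon>\<close> if the graphs lie in disjoint
  compact sets, which settles the second case.
\<close>

section \<open>The Hermite--Hadamard inequality for a concave derivative\<close>

lemma concave_on_ge_chord:
  fixes g :: "real \<Rightarrow> real"
  assumes "concave_on {a..b} g" and "a < b" and x: "x \<in> {a..b}"
  shows "g a + (g b - g a) / (b - a) * (x - a) \<le> g x"
proof -
  define t where "t = (x - a) / (b - a)"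
  have t: "0 \<le> t" "t \<le> 1" using x assms(2) by (auto simp: t_def)
  have "t * (b - a) = x - a" using assms(2) by (simp add: t_def)
  then have "x = (1 - t) *\<^sub>R a + t *\<^sub>R b" by (simp add: algebra_simps)
  with concave_onD[OF assms(1) t, of a b] assms(2)
  have "(1 - t) * g a + t * g b \<le> g x" by auto
  then show ?thesis by (simp add: t_def algebra_simps diff_divide_distrib)
qed

text \<open>
  With \<open>l\<close> the affine interpolant of \<open>g\<close> at the two ends, \<open>H = G - \<integral>l\<close> satisfies
  \<open>H' = g - l \<ge> 0\<close>, and \<open>H b - H a\<close> is exactly the defect of the inequality. Equality would make
  the monotone function \<open>H\<close> constant and so force \<open>g = l\<close> inside the interval.
\<close>

lemma hermite_hadamard_concave:
  fixes G g :: "real \<Rightarrow> real"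
  assumes conc: "concave_on {a..b} g" and "a < b"
    and G: "\<And>x. x \<in> {a..b} \<Longrightarrow> (G has_real_derivative g x) (at x)"
  shows "(g a + g b) / 2 * (b - a) \<le> G b - G a"
    and "\<lbrakk>a \<le> x - h; x + h \<le> b; 0 < h; g (x - h) + g (x + h) < 2 * g x\<rbrakk>
           \<Longrightarrow> (g a + g b) / 2 * (b - a) < G b - G a"
proof -
  define s where "s = (g b - g a) / (b - a)"
  define l where "l y = g a + s * (y - a)" for y
  define H where "H y = G y - (g a * (y - a) + s * (y - a)\<^sup>2 / 2)" for y
  have chord: "l y \<le> g y" if "y \<in> {a..b}" for y
    using concave_on_ge_chord[OF conc \<open>a < b\<close> that] by (simp add: l_def s_def)
  have dH: "(H has_real_derivative (g y - l y)) (at y)" if "y \<in> {a..b}" for y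
    unfolding H_def l_def
    by (auto intro!: derivative_eq_intros G[OF that])
  have mono: "H y \<le> H z" if "a \<le> y" "y \<le> z" "z \<le> b" for y z
  proof (rule DERIV_nonneg_imp_nondecreasing[OF that(2)])
    fix w assume "y \<le> w" "w \<le> z"
    then have "w \<in> {a..b}" using that by auto
    from dH[OF this] chord[OF this]
    show "\<exists>d. (H has_real_derivative d) (at w) \<and> 0 \<le> d" by force
  qed
  have "s * (b - a) = g b - g a" using \<open>a < b\<close> by (simp add: s_def)
  then have "s * (b - a)\<^sup>2 = (g b - g a) * (b - a)" by (simp add: power2_eq_square)
  then have HbHa: "H b - H a = G b - G a - (g a + g b) / 2 * (b - a)"
    by (simp add: H_def field_simps)
  then show "(g a + g b) / 2 * (b - a) \<le> G b - G a"
    using mono[of a b] \<open>a < b\<close> by simp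
  assume x: "a \<le> x - h" "x + h \<le> b" "0 < h" "g (x - h) + g (x + h) < 2 * g x"
  have "l (x - h) + l (x + h) = 2 * l x" by (simp add: l_def algebra_simps)
  with chord[of "x - h"] chord[of "x + h"] x have above: "l x < g x" by auto
  have xab: "a < x" "x < b" using x by auto
  show "(g a + g b) / 2 * (b - a) < G b - G a"
  proof (rule ccontr)
    assume "\<not> ?thesis"
    then have "H b \<le> H a" using HbHa by simp
    then have const: "H y = H x" if "y \<in> {a<..<b}" for y
      using mono[of a y] mono[of y b] mono[of a x] mono[of x b] that xab by auto
    have "(H has_real_derivative 0) (at x)"
    proof (rule has_field_derivative_transform_within_open[of "\<lambda>_. H x" _ _ "{a<..<b}"])
      show "x \<in> {a<..<b}" using xab by simp
    qed (use const in auto)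
    then have "g x - l x = 0" using DERIV_unique dH[of x] xab by fastforce
    with above show False by simp
  qed
qed

section \<open>Exponential control of a separation\<close>

lemma exponential_comparison_forward:
  fixes D D' :: "real \<Rightarrow> real"
  assumes "s \<le> t"
    and D: "\<And>r. \<lbrakk>s \<le> r; r \<le> t\<rbrakk> \<Longrightarrow> (D has_real_derivative D' r) (at r)"
    and bd: "\<And>r. \<lbrakk>s \<le> r; r \<le> t\<rbrakk> \<Longrightarrow> \<bar>D' r\<bar> \<le> L * \<bar>D r\<bar>"
  shows "\<bar>D t\<bar> \<le> \<bar>D s\<bar> * exp (L * (t - s))"
proof -
  \<comment> \<open>The square makes the quantity differentiable at the zeros of \<open>D\<close> as well.\<close>
  have "(D t * exp (- L * t))\<^sup>2 \<le> (D s * exp (- L * s))\<^sup>2"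
  proof (rule DERIV_nonpos_imp_nonincreasing[OF assms(1)])
    fix r assume r: "s \<le> r" "r \<le> t"
    define e where "e = exp (- L * r)"
    have "((\<lambda>r. (D r * exp (- L * r))\<^sup>2) has_real_derivative
            2 * (D r * e) * (D' r * e + D r * (e * - L))) (at r)"
      unfolding e_def
      by (auto intro!: derivative_eq_intros D[OF r])
    moreover have "D r * D' r \<le> L * (D r * D r)"
      using mult_left_mono[OF bd[OF r], of "\<bar>D r\<bar>"] abs_ge_self[of "D r * D' r"]
      by (simp add: abs_mult mult.left_commute)
    then have "e * e * (D r * D' r) \<le> e * e * (L * (D r * D r))"
      by (rule mult_left_mono) simp
    then have "2 * (D r * e) * (D' r * e + D r * (e * - L)) \<le> 0"
      by (simp add: algebra_simps)
    ultimately show "\<exists>y. ((\<lambda>r. (D r * exp (- L * r))\<^sup>2) has_real_derivative y) (at r) \<and> y \<le> 0"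
      by blast
  qed
  then have "\<bar>D t\<bar> * exp (- L * t) \<le> \<bar>D s\<bar> * exp (- L * s)"
    by (simp add: abs_mult flip: abs_le_square_iff)
  then have "\<bar>D t\<bar> * exp (- L * t) * exp (L * t) \<le> \<bar>D s\<bar> * exp (- L * s) * exp (L * t)"
    by (rule mult_right_mono) simp
  then have "\<bar>D t\<bar> * exp (- L * t + L * t) \<le> \<bar>D s\<bar> * exp (- L * s + L * t)"
    unfolding exp_add by (simp only: mult.assoc)
  then show ?thesis by (simp add: algebra_simps)
qed

text \<open>
  The two-sided form, symmetric in \<open>s\<close> and \<open>t\<close>, is what makes the vanishing of \<open>D\<close> at one time
  equivalent to its vanishing at every other: it yields both uniqueness of solutions and the
  invariance of the set where two equilibria meet. Backward times follow by time reversal.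
\<close>

lemma exponential_comparison:
  fixes D D' :: "real \<Rightarrow> real"
  assumes "is_interval I" and s: "s \<in> I" and t: "t \<in> I"
    and D: "\<And>r. r \<in> I \<Longrightarrow> (D has_real_derivative D' r) (at r)"
    and bd: "\<And>r. r \<in> I \<Longrightarrow> \<bar>D' r\<bar> \<le> L * \<bar>D r\<bar>"
  shows "\<bar>D t\<bar> \<le> \<bar>D s\<bar> * exp (L * \<bar>t - s\<bar>)"
proof (cases "s \<le> t")
  case True
  have "r \<in> I" if "s \<le> r" "r \<le> t" for r
    using assms(1) s t that unfolding is_interval_1 by blast
  with exponential_comparison_forward[OF True, of D D' L] D bd True show ?thesis by simp
next
  case False
  have I: "- r \<in> I" if "- s \<le> r" "r \<le> - t" for r
    using assms(1) s t that unfolding is_interval_1 by (meson minus_le_iff le_minus_iff)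
  have "((\<lambda>r. D (- r)) has_real_derivative - D' (- r)) (at r)" if "- r \<in> I" for r
    using D[OF that] by (simp add: DERIV_mirror)
  with exponential_comparison_forward[of "- s" "- t" "\<lambda>r. D (- r)" "\<lambda>r. - D' (- r)" L] bd I False
  show ?thesis by simp
qed

section \<open>Caratheodory functions\<close>

text \<open>
  A function measurable in \<open>\<omega>\<close> and continuous in a real parameter may be evaluated at a
  measurable parameter: approximating the parameter by multiples of \<open>1/(n+1)\<close> leaves countably
  many measurable pieces. Joint continuity would not do as directly, since the Borel
  \<open>\<sigma>\<close>-algebra of a product can be larger than the product of the Borel \<open>\<sigma>\<close>-algebras.
\<close>

lemma borel_measurable_compose_parameter:
  fixes \<phi> :: "real \<Rightarrow> 'a \<Rightarrow> 'b::metric_space"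
  assumes meas: "\<And>x. \<phi> x \<in> borel_measurable M"
    and cont: "\<And>\<omega>. continuous_on UNIV (\<lambda>x. \<phi> x \<omega>)"
    and \<beta>[measurable]: "\<beta> \<in> borel_measurable M"
  shows "(\<lambda>\<omega>. \<phi> (\<beta> \<omega>) \<omega>) \<in> borel_measurable M"
proof (rule borel_measurable_LIMSEQ_metric)
  fix n :: nat
  show "(\<lambda>\<omega>. \<phi> (of_int \<lfloor>real (Suc n) * \<beta> \<omega>\<rfloor> / real (Suc n)) \<omega>) \<in> borel_measurable M"
    by (rule measurable_compose_countable[where f = "\<lambda>i \<omega>. \<phi> (of_int i / real (Suc n)) \<omega>"])
      (use meas in measurable)
next
  fix \<omega>
  have "(\<lambda>n. of_int \<lfloor>real (Suc n) * \<beta> \<omega>\<rfloor> / real (Suc n)) \<longlonglongrightarrow> \<beta> \<omega>"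
  proof (rule tendsto_sandwich)
    have "(\<lambda>n. \<beta> \<omega> - 1 / real (Suc n)) \<longlonglongrightarrow> \<beta> \<omega> - 0"
      by (intro tendsto_intros LIMSEQ_inverse_real_of_nat[unfolded inverse_eq_divide])
    then show "(\<lambda>n. \<beta> \<omega> - 1 / real (Suc n)) \<longlonglongrightarrow> \<beta> \<omega>" by simp
    have "\<beta> \<omega> - 1 / real (Suc n) \<le> of_int \<lfloor>real (Suc n) * \<beta> \<omega>\<rfloor> / real (Suc n)" for n
    proof -
      have "\<beta> \<omega> - 1 / real (Suc n) = (real (Suc n) * \<beta> \<omega> - 1) / real (Suc n)"
        by (simp add: field_simps del: of_nat_Suc)
      also have "\<dots> \<le> of_int \<lfloor>real (Suc n) * \<beta> \<omega>\<rfloor> / real (Suc n)"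
        by (rule divide_right_mono) linarith+
      finally show ?thesis .
    qed
    then show "\<forall>\<^sub>F n in sequentially. \<beta> \<omega> - 1 / real (Suc n) \<le> of_int \<lfloor>real (Suc n) * \<beta> \<omega>\<rfloor> / real (Suc n)"
      by simp
    have "of_int \<lfloor>real (Suc n) * \<beta> \<omega>\<rfloor> / real (Suc n) \<le> \<beta> \<omega>" for n
    proof -
      have "of_int \<lfloor>real (Suc n) * \<beta> \<omega>\<rfloor> / real (Suc n) \<le> (real (Suc n) * \<beta> \<omega>) / real (Suc n)"
        by (rule divide_right_mono) linarith+
      then show ?thesis by (simp del: of_nat_Suc)
    qed
    then show "\<forall>\<^sub>F n in sequentially. of_int \<lfloor>real (Suc n) * \<beta> \<omega>\<rfloor> / real (Suc n) \<le> \<beta> \<omega>"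
      by simp
  qed simp
  then show "(\<lambda>n. \<phi> (of_int \<lfloor>real (Suc n) * \<beta> \<omega>\<rfloor> / real (Suc n)) \<omega>) \<longlonglongrightarrow> \<phi> (\<beta> \<omega>) \<omega>"
    by (rule continuous_on_tendsto_compose[OF cont]) auto
qed

section \<open>Coboundaries have zero mean\<close>

text \<open>
  The function \<open>h\<close> need not be integrable, so the integral cannot be split. Truncating \<open>h\<close> at
  height \<open>n\<close> gives bounded functions, for which invariance of the measure applies; truncation is
  1-Lipschitz, so the truncated differences are dominated by \<open>C\<close> and the limit passes through.
\<close>

lemma integral_coboundary_eq_0:
  fixes h :: "'a \<Rightarrow> real"
  assumes fin: "finite_measure M" and T[measurable]: "T \<in> M \<rightarrow>\<^sub>M M" and inv: "distr M M T = M"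
    and h[measurable]: "h \<in> borel_measurable M"
    and bd: "AE \<omega> in M. \<bar>h (T \<omega>) - h \<omega>\<bar> \<le> C"
  shows "(\<integral>\<omega>. h (T \<omega>) - h \<omega> \<partial>M) = 0"
proof -
  interpret finite_measure M by fact
  define k where "k n \<omega> = max (- real n) (min (real n) (h \<omega>))" for n \<omega>
  have k[measurable]: "k n \<in> borel_measurable M" for n unfolding k_def by measurable
  have kint: "integrable M (k n)" for n
    by (rule integrable_const_bound[where B = "real n"]) (auto simp: k_def)
  have "integrable (distr M M T) (k n)" for n using kint by (simp add: inv)
  then have kTint: "integrable M (\<lambda>\<omega>. k n (T \<omega>))" for n
    by (simp add: integrable_distr_eq)
  have "(\<integral>\<omega>. k n (T \<omega>) \<partial>M) = (\<integral>\<omega>. k n \<omega> \<partial>distr M M T)" for n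
    by (simp add: integral_distr)
  then have zero: "(\<integral>\<omega>. k n (T \<omega>) - k n \<omega> \<partial>M) = 0" for n
    by (simp add: inv kint kTint)
  have kev: "\<forall>\<^sub>F n in sequentially. k n \<omega> = h \<omega>" for \<omega>
  proof -
    obtain N where "\<bar>h \<omega>\<bar> \<le> real N" using real_arch_simple by blast
    then show ?thesis
      by (intro eventually_sequentiallyI[of N]) (auto simp: k_def min_def max_def)
  qed
  have "(\<lambda>n. \<integral>\<omega>. k n (T \<omega>) - k n \<omega> \<partial>M) \<longlonglongrightarrow> (\<integral>\<omega>. h (T \<omega>) - h \<omega> \<partial>M)"
  proof (rule integral_dominated_convergence[where w = "\<lambda>_. C"])
    show "AE \<omega> in M. (\<lambda>n. k n (T \<omega>) - k n \<omega>) \<longlonglongrightarrow> h (T \<omega>) - h \<omega>"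
      using kev by (intro AE_I2 tendsto_diff tendsto_eventually)
    show "AE \<omega> in M. norm (k n (T \<omega>) - k n \<omega>) \<le> C" for n
      using bd by eventually_elim (auto simp: k_def max_def min_def)
  qed auto
  then have "(\<lambda>n::nat. 0) \<longlonglongrightarrow> (\<integral>\<omega>. h (T \<omega>) - h \<omega> \<partial>M)"
    by (simp only: zero)
  then show ?thesis by (simp add: LIMSEQ_const_iff)
qed

section \<open>Solutions and equilibria of the scalar equation\<close>

lemma C0k_2_D:
  assumes "C0k 2 f"
  shows "(f \<omega> has_real_derivative f_x f \<omega> x) (at x)"
    and "continuous_on UNIV (\<lambda>(\<omega>, x). f \<omega> x)"
    and "continuous_on UNIV (\<lambda>(\<omega>, x). f_x f \<omega> x)"
proof -
  have c: "continuous_on UNIV (\<lambda>(\<omega>, x). (deriv ^^ i) (f \<omega>) x)" if "i \<le> 2" for i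
    using assms that unfolding C0k_def by blast
  have "(deriv ^^ 0) (f \<omega>) field_differentiable (at x)"
    using assms unfolding C0k_def by (metis zero_less_numeral)
  then show "(f \<omega> has_real_derivative f_x f \<omega> x) (at x)"
    by (simp add: DERIV_deriv_iff_field_differentiable)
  show "continuous_on UNIV (\<lambda>(\<omega>, x). f \<omega> x)" using c[of 0] by simp
  show "continuous_on UNIV (\<lambda>(\<omega>, x). f_x f \<omega> x)" using c[of 1] by simp
qed

lemma C0k_2_lipschitz:
  fixes f :: "'w::metric_space \<Rightarrow> real \<Rightarrow> real"
  assumes "compact (UNIV :: 'w set)" and f: "C0k 2 f"
  obtains L where "0 \<le> L"
    and "\<And>\<omega> x. \<bar>x\<bar> \<le> R \<Longrightarrow> \<bar>f_x f \<omega> x\<bar> \<le> L"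
    and "\<And>\<omega> x y. \<lbrakk>\<bar>x\<bar> \<le> R; \<bar>y\<bar> \<le> R\<rbrakk> \<Longrightarrow> \<bar>f \<omega> x - f \<omega> y\<bar> \<le> L * \<bar>x - y\<bar>"
proof -
  have "compact ((UNIV :: 'w set) \<times> {- R..R})"
    by (intro compact_Times assms(1)) auto
  then have "compact ((\<lambda>(\<omega>, x). f_x f \<omega> x) ` ((UNIV :: 'w set) \<times> {- R..R}))"
    by (intro compact_continuous_image continuous_on_subset[OF C0k_2_D(3)[OF f]]) auto
  then obtain L where L: "\<forall>y\<in>(\<lambda>(\<omega>, x). f_x f \<omega> x) ` ((UNIV :: 'w set) \<times> {- R..R}). norm y \<le> L"
    using compact_imp_bounded bounded_iff by blast
  have bd: "\<bar>f_x f \<omega> x\<bar> \<le> max L 0" if "\<bar>x\<bar> \<le> R" for \<omega> x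
  proof -
    have "f_x f \<omega> x \<in> (\<lambda>(\<omega>, x). f_x f \<omega> x) ` (UNIV \<times> {- R..R})"
      using that by (intro image_eqI[of _ _ "(\<omega>, x)"]) auto
    with L have "norm (f_x f \<omega> x) \<le> L" by (rule bspec)
    then show ?thesis by simp
  qed
  have "\<bar>f \<omega> x - f \<omega> y\<bar> \<le> max L 0 * \<bar>x - y\<bar>" if "\<bar>x\<bar> \<le> R" "\<bar>y\<bar> \<le> R" for \<omega> x y
    using field_differentiable_bound[of "{- R..R}" "f \<omega>" "f_x f \<omega>" "max L 0" x y]
      C0k_2_D(1)[OF f] bd that
    by (auto simp: DERIV_subset abs_le_iff intro: has_field_derivative_at_within)
  with bd show ?thesis by (intro that[of "max L 0"]) auto
qed

lemma is_solution_unique: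
  fixes f :: "'w::metric_space \<Rightarrow> real \<Rightarrow> real"
  assumes "compact (UNIV :: 'w set)" and "C0k 2 f"
    and v: "is_solution \<sigma> f \<omega> x I v" and w: "is_solution \<sigma> f \<omega> x J w"
    and t: "t \<in> I" "t \<in> J"
  shows "v t = w t"
proof -
  define S where "S = closed_segment 0 t"
  have int: "is_interval I" "is_interval J" "0 \<in> I" "0 \<in> J"
    using v w by (auto simp: is_solution_def)
  then have S: "S \<subseteq> I" "S \<subseteq> J"
    using t unfolding S_def is_interval_convex_1 by (simp_all add: closed_segment_subset)
  have dv: "(v has_real_derivative f (\<sigma> r \<omega>) (v r)) (at r)"
    and dw: "(w has_real_derivative f (\<sigma> r \<omega>) (w r)) (at r)" if "r \<in> S" for r
    using v w S that by (auto simp: is_solution_def)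
  have "continuous_on S v" "continuous_on S w"
    using dv dw by (auto intro!: continuous_at_imp_continuous_on intro: DERIV_isCont)
  then have "compact (v ` S)" "compact (w ` S)"
    by (auto simp: S_def intro!: compact_continuous_image)
  then have "bounded (v ` S \<union> w ` S)" by (simp add: compact_imp_bounded)
  then obtain R where R: "\<And>r. r \<in> S \<Longrightarrow> \<bar>v r\<bar> \<le> R \<and> \<bar>w r\<bar> \<le> R"
    unfolding bounded_iff by force
  obtain L where L: "\<And>\<omega> x y. \<lbrakk>\<bar>x\<bar> \<le> R; \<bar>y\<bar> \<le> R\<rbrakk> \<Longrightarrow> \<bar>f \<omega> x - f \<omega> y\<bar> \<le> L * \<bar>x - y\<bar>"
    using C0k_2_lipschitz[OF assms(1,2)] by metis
  have "\<bar>v t - w t\<bar> \<le> \<bar>v 0 - w 0\<bar> * exp (L * \<bar>t - 0\<bar>)"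
    by (rule exponential_comparison[of S _ _ "\<lambda>r. v r - w r" "\<lambda>r. f (\<sigma> r \<omega>) (v r) - f (\<sigma> r \<omega>) (w r)"])
      (use R L in \<open>auto simp: S_def is_interval_convex_1 intro!: DERIV_diff dv[unfolded S_def] dw[unfolded S_def]\<close>)
  moreover have "v 0 = w 0" using v w by (simp add: is_solution_def)
  ultimately show ?thesis by simp
qed

text \<open>
  Uniqueness turns the glued value \<open>max_solution\<close> into the value of any local solution through
  the point, so an equilibrium read along an orbit is itself a solution.
\<close>

lemma tau_equilibrium_has_derivative:
  fixes f :: "'w::metric_space \<Rightarrow> real \<Rightarrow> real"
  assumes "compact (UNIV :: 'w set)" and "C0k 2 f" and \<beta>: "tau_equilibrium \<sigma> f \<beta>"
  shows "((\<lambda>t. \<beta> (\<sigma> t \<omega>)) has_real_derivative f (\<sigma> t \<omega>) (\<beta> (\<sigma> t \<omega>))) (at t)"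
proof -
  have "t \<in> max_interval \<sigma> f \<omega> (\<beta> \<omega>)" using \<beta> by (simp add: tau_equilibrium_def)
  then obtain I v where v: "is_solution \<sigma> f \<omega> (\<beta> \<omega>) I v" and t: "t \<in> I"
    by (auto simp: max_interval_def)
  have eq: "\<beta> (\<sigma> s \<omega>) = v s" if "s \<in> I" for s
  proof -
    have "\<beta> (\<sigma> s \<omega>) = max_solution \<sigma> f s \<omega> (\<beta> \<omega>)" using \<beta> by (simp add: tau_equilibrium_def)
    also have "\<dots> = v s"
      unfolding max_solution_def
      by (rule the_equality) (use v that is_solution_unique[OF assms(1,2) _ v _ that] in blast)+
    finally show ?thesis .
  qed
  have "(v has_real_derivative f (\<sigma> t \<omega>) (v t)) (at t)" and "open I"
    using v t by (auto simp: is_solution_def)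
  from has_field_derivative_transform_within_open[OF this t eq[symmetric]] eq[OF t]
  show ?thesis by simp
qed

text \<open>
  For two equilibria, and where they differ, this is the logarithmic derivative of
  \<open>\<bar>\<beta> - \<gamma>\<bar>\<close> along the flow; it is also the average of \<open>f_x f \<omega>\<close> over the interval between
  \<open>\<beta> \<omega>\<close> and \<open>\<gamma> \<omega>\<close>. Its value is \<open>0\<close> where they meet.
\<close>

definition separation_rate ::
  "('w \<Rightarrow> real \<Rightarrow> real) \<Rightarrow> ('w \<Rightarrow> real) \<Rightarrow> ('w \<Rightarrow> real) \<Rightarrow> 'w \<Rightarrow> real" where
  "separation_rate f \<beta> \<gamma> \<omega> = (f \<omega> (\<beta> \<omega>) - f \<omega> (\<gamma> \<omega>)) / (\<beta> \<omega> - \<gamma> \<omega>)"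

context
  fixes \<sigma> :: "real \<Rightarrow> 'w::metric_space \<Rightarrow> 'w" and f :: "'w \<Rightarrow> real \<Rightarrow> real"
    and \<beta> \<gamma> :: "'w \<Rightarrow> real" and L :: real
  assumes compact: "compact (UNIV :: 'w set)" and flow: "continuous_flow \<sigma>" and f: "C0k 2 f"
    and \<beta>: "tau_equilibrium \<sigma> f \<beta>" and \<gamma>: "tau_equilibrium \<sigma> f \<gamma>"
    and lip: "\<And>\<omega>. \<bar>f \<omega> (\<beta> \<omega>) - f \<omega> (\<gamma> \<omega>)\<bar> \<le> L * \<bar>\<beta> \<omega> - \<gamma> \<omega>\<bar>"
begin

lemma equilibria_separation_bounds:
  shows "\<bar>\<beta> (\<sigma> t \<omega>) - \<gamma> (\<sigma> t \<omega>)\<bar> \<le> \<bar>\<beta> \<omega> - \<gamma> \<omega>\<bar> * exp (L * \<bar>t\<bar>)"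
    and "\<bar>\<beta> \<omega> - \<gamma> \<omega>\<bar> \<le> \<bar>\<beta> (\<sigma> t \<omega>) - \<gamma> (\<sigma> t \<omega>)\<bar> * exp (L * \<bar>t\<bar>)"
proof -
  have *: "\<bar>\<beta> (\<sigma> t \<omega>) - \<gamma> (\<sigma> t \<omega>)\<bar> \<le> \<bar>\<beta> (\<sigma> s \<omega>) - \<gamma> (\<sigma> s \<omega>)\<bar> * exp (L * \<bar>t - s\<bar>)" for s t
    by (rule exponential_comparison[of UNIV s t "\<lambda>t. \<beta> (\<sigma> t \<omega>) - \<gamma> (\<sigma> t \<omega>)"
          "\<lambda>t. f (\<sigma> t \<omega>) (\<beta> (\<sigma> t \<omega>)) - f (\<sigma> t \<omega>) (\<gamma> (\<sigma> t \<omega>))"])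
      (auto intro!: DERIV_diff tau_equilibrium_has_derivative compact f \<beta> \<gamma> lip)
  have "\<sigma> 0 \<omega> = \<omega>" using flow by (simp add: continuous_flow_def)
  with *[of t 0] *[of 0 t]
  show "\<bar>\<beta> (\<sigma> t \<omega>) - \<gamma> (\<sigma> t \<omega>)\<bar> \<le> \<bar>\<beta> \<omega> - \<gamma> \<omega>\<bar> * exp (L * \<bar>t\<bar>)"
    and "\<bar>\<beta> \<omega> - \<gamma> \<omega>\<bar> \<le> \<bar>\<beta> (\<sigma> t \<omega>) - \<gamma> (\<sigma> t \<omega>)\<bar> * exp (L * \<bar>t\<bar>)" by auto
qed

lemma equilibria_meet_invariant: "\<beta> (\<sigma> t \<omega>) = \<gamma> (\<sigma> t \<omega>) \<longleftrightarrow> \<beta> \<omega> = \<gamma> \<omega>"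
  using equilibria_separation_bounds[where t = t and \<omega> = \<omega>] by fastforce

lemma ln_separation_lipschitz:
  assumes ne: "\<beta> \<omega> \<noteq> \<gamma> \<omega>"
  shows "\<bar>ln \<bar>\<beta> (\<sigma> t \<omega>) - \<gamma> (\<sigma> t \<omega>)\<bar> - ln \<bar>\<beta> \<omega> - \<gamma> \<omega>\<bar>\<bar> \<le> L * \<bar>t\<bar>"
proof -
  have ne': "\<beta> (\<sigma> t \<omega>) \<noteq> \<gamma> (\<sigma> t \<omega>)" using ne equilibria_meet_invariant by simp
  have "ln \<bar>\<beta> (\<sigma> t \<omega>) - \<gamma> (\<sigma> t \<omega>)\<bar> \<le> ln (\<bar>\<beta> \<omega> - \<gamma> \<omega>\<bar> * exp (L * \<bar>t\<bar>))"
    "ln \<bar>\<beta> \<omega> - \<gamma> \<omega>\<bar> \<le> ln (\<bar>\<beta> (\<sigma> t \<omega>) - \<gamma> (\<sigma> t \<omega>)\<bar> * exp (L * \<bar>t\<bar>))"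
    using equilibria_separation_bounds[where t = t and \<omega> = \<omega>] ne ne'
    by (auto intro!: ln_mono)
  with ne ne' show ?thesis unfolding abs_le_iff by (simp add: ln_mult)
qed

lemma ln_separation_has_derivative:
  assumes ne: "\<beta> \<omega> \<noteq> \<gamma> \<omega>"
  shows "((\<lambda>t. ln \<bar>\<beta> (\<sigma> t \<omega>) - \<gamma> (\<sigma> t \<omega>)\<bar>) has_real_derivative separation_rate f \<beta> \<gamma> \<omega>) (at 0)"
proof -
  define D where "D t = \<beta> (\<sigma> t \<omega>) - \<gamma> (\<sigma> t \<omega>)" for t
  have 0: "\<sigma> 0 \<omega> = \<omega>" using flow by (simp add: continuous_flow_def)
  have dD: "(D has_real_derivative f \<omega> (\<beta> \<omega>) - f \<omega> (\<gamma> \<omega>)) (at 0)"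
    using DERIV_diff[OF tau_equilibrium_has_derivative[OF compact f \<beta>, of \<omega> 0]
        tau_equilibrium_has_derivative[OF compact f \<gamma>, of \<omega> 0]]
    by (simp add: D_def[abs_def] 0)
  have "D 0 \<noteq> 0" using ne by (simp add: D_def 0)
  then have "((\<lambda>t. ln (D t * D t) / 2) has_real_derivative (f \<omega> (\<beta> \<omega>) - f \<omega> (\<gamma> \<omega>)) / D 0) (at 0)"
    by (auto intro!: derivative_eq_intros dD simp: zero_less_mult_iff field_simps)
  \<comment> \<open>This holds at \<open>y = 0\<close> too, because \<open>ln 0 = 0\<close>.\<close>
  moreover have "ln \<bar>y\<bar> = ln (y * y) / 2" for y :: real
    by (simp add: ln_mult abs_if ln_minus)
  ultimately have "((\<lambda>t. ln \<bar>D t\<bar>) has_real_derivative (f \<omega> (\<beta> \<omega>) - f \<omega> (\<gamma> \<omega>)) / D 0) (at 0)"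
    by (simp only:)
  then show ?thesis by (simp add: D_def separation_rate_def 0)
qed

end

section \<open>Ergodic measures of a continuous flow\<close>

context
  fixes \<sigma> :: "real \<Rightarrow> 'w::metric_space \<Rightarrow> 'w" and m :: "'w measure"
  assumes flow: "continuous_flow \<sigma>" and m: "m \<in> erg_measures \<sigma>"
begin

lemma flow_0: "\<sigma> 0 \<omega> = \<omega>"
  and flow_add: "\<sigma> (s + t) \<omega> = \<sigma> s (\<sigma> t \<omega>)"
  using flow by (auto simp: continuous_flow_def)

lemma flow_image_eq_vimage: "\<sigma> t ` A = \<sigma> (- t) -` A"
proof (intro set_eqI iffI)
  fix \<omega> assume "\<omega> \<in> \<sigma> (- t) -` A"
  then show "\<omega> \<in> \<sigma> t ` A"
    by (intro image_eqI[of _ _ "\<sigma> (- t) \<omega>"]) (simp_all add: flow_0 flip: flow_add)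
qed (auto simp: flow_0 simp flip: flow_add)

lemma sets_m[measurable_cong]: "sets m = sets borel"
  and prob_space_m: "prob_space m"
  using m by (auto simp: erg_measures_def)

lemma space_m: "space m = UNIV"
  using sets_eq_imp_space_eq[OF sets_m] by simp

lemma continuous_on_flow_space: "continuous_on UNIV (\<sigma> t)"
  and continuous_on_flow_time: "continuous_on UNIV (\<lambda>t. \<sigma> t \<omega>)"
proof -
  have c: "continuous_on UNIV (\<lambda>(t, \<omega>). \<sigma> t \<omega>)"
    using flow by (simp add: continuous_flow_def)
  show "continuous_on UNIV (\<sigma> t)"
    using continuous_on_compose2[OF c, of UNIV "\<lambda>\<omega>. (t, \<omega>)"]
    by (simp add: continuous_on_Pair)
  show "continuous_on UNIV (\<lambda>t. \<sigma> t \<omega>)"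
    using continuous_on_compose2[OF c, of UNIV "\<lambda>t. (t, \<omega>)"]
    by (simp add: continuous_on_Pair)
qed

lemma measurable_flow_space: "\<sigma> t \<in> m \<rightarrow>\<^sub>M m"
  using borel_measurable_continuous_onI[OF continuous_on_flow_space]
  by (simp cong: measurable_cong_sets add: sets_m)

lemma measurable_flow: "(\<lambda>(t, \<omega>). \<sigma> t \<omega>) \<in> lborel \<Otimes>\<^sub>M m \<rightarrow>\<^sub>M m"
proof -
  have 1: "(\<lambda>p. \<sigma> t (snd p)) \<in> borel_measurable (lborel \<Otimes>\<^sub>M m)" for t
    using measurable_compose[OF measurable_snd measurable_flow_space]
    by (simp cong: measurable_cong_sets add: sets_m)
  have "(\<lambda>p. \<sigma> (fst p) (snd p)) \<in> borel_measurable (lborel \<Otimes>\<^sub>M m)"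
    by (rule borel_measurable_compose_parameter[of "\<lambda>t p. \<sigma> t (snd p)"])
      (auto intro: 1 continuous_on_flow_time)
  then show ?thesis
    by (simp cong: measurable_cong_sets add: sets_m case_prod_beta')
qed

lemma distr_flow: "distr m m (\<sigma> t) = m"
proof (rule measure_eqI)
  fix A assume "A \<in> sets (distr m m (\<sigma> t))"
  then have A: "A \<in> sets borel" by (simp add: sets_m)
  have "emeasure (distr m m (\<sigma> t)) A = emeasure m (\<sigma> t -` A)"
    using A by (simp add: emeasure_distr measurable_flow_space sets_m space_m)
  also have "\<sigma> t -` A = \<sigma> (- t) ` A" by (simp add: flow_image_eq_vimage)
  also have "emeasure m \<dots> = emeasure m A" using m A by (simp add: erg_measures_def)
  finally show "emeasure (distr m m (\<sigma> t)) A = emeasure m A" .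
qed simp

lemma AE_flow: "AE \<omega> in m. P \<omega> \<Longrightarrow> AE \<omega> in m. P (\<sigma> t \<omega>)"
  by (rule AE_distrD[OF measurable_flow_space]) (unfold distr_flow)

text \<open>
  Ergodicity speaks of Borel sets that are exactly invariant under every time map, whereas a
  Borel set \<open>B\<close> that agrees with \<open>A\<close> almost everywhere is only invariant up to null sets, which
  depend on the time. The set \<open>C\<close> of points whose orbit lies in \<open>B\<close> for Lebesgue-almost every
  time is Borel, is exactly invariant by translation invariance of Lebesgue measure, and agrees
  with \<open>A\<close> almost everywhere by Fubini.
\<close>

lemma ergodic_invariant_set_completion:
  assumes A: "A \<in> sets (completion m)" and inv: "\<And>t \<omega>. \<sigma> t \<omega> \<in> A \<longleftrightarrow> \<omega> \<in> A"
  shows "(AE \<omega> in m. \<omega> \<in> A) \<or> (AE \<omega> in m. \<omega> \<notin> A)"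
proof -
  interpret prob_space m by (rule prob_space_m)
  interpret P: pair_sigma_finite lborel m ..
  have "(indicator A :: 'w \<Rightarrow> real) \<in> borel_measurable (completion m)" using A by measurable
  then obtain g :: "'w \<Rightarrow> real" where g[measurable]: "g \<in> borel_measurable m"
    and gA: "AE \<omega> in m. indicator A \<omega> = g \<omega>"
    using completion_ex_borel_measurable_real by blast
  define B where "B = {\<omega> \<in> space m. g \<omega> = 1}"
  have B[measurable]: "B \<in> sets m" unfolding B_def by measurable
  have AB: "AE \<omega> in m. \<omega> \<in> A \<longleftrightarrow> \<omega> \<in> B"
    using gA by eventually_elim (auto simp: B_def space_m indicator_def split: if_splits)
  note [measurable] = measurable_flow_space
  define C where "C = {\<omega>. AE t in lborel. \<sigma> t \<omega> \<in> B}"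
  have [measurable]: "(\<lambda>p. \<sigma> (fst p) (snd p)) \<in> lborel \<Otimes>\<^sub>M m \<rightarrow>\<^sub>M m"
    using measurable_flow by (simp add: case_prod_beta')
  have [measurable]: "(\<lambda>p. \<sigma> (snd p) (fst p)) \<in> m \<Otimes>\<^sub>M lborel \<rightarrow>\<^sub>M m"
    using measurable_compose[OF measurable_pair_swap' measurable_flow] by (simp add: case_prod_beta')
  have "AE \<omega> in m. AE t in lborel. \<sigma> t \<omega> \<in> B \<longleftrightarrow> \<omega> \<in> B"
  proof (subst P.AE_commute[symmetric])
    show "{p \<in> space (lborel \<Otimes>\<^sub>M m). \<sigma> (fst p) (snd p) \<in> B \<longleftrightarrow> snd p \<in> B} \<in> sets (lborel \<Otimes>\<^sub>M m)"
      by measurable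
    have "AE \<omega> in m. \<sigma> t \<omega> \<in> B \<longleftrightarrow> \<omega> \<in> B" for t
      using AB AE_flow[OF AB, of t] by eventually_elim (simp add: inv)
    then show "AE t in lborel. AE \<omega> in m. \<sigma> t \<omega> \<in> B \<longleftrightarrow> \<omega> \<in> B" by simp
  qed
  then have AC: "AE \<omega> in m. \<omega> \<in> A \<longleftrightarrow> \<omega> \<in> C"
    using AB
  proof eventually_elim
    case (elim \<omega>)
    have "\<omega> \<in> B \<longleftrightarrow> \<omega> \<in> C"
    proof
      assume "\<omega> \<in> B" with elim(1) show "\<omega> \<in> C" by (simp add: C_def)
    next
      assume "\<omega> \<in> C"
      then have "AE t in lborel. \<sigma> t \<omega> \<in> B" by (simp add: C_def)
      with elim(1) have "AE t in (lborel :: real measure). \<omega> \<in> B" by eventually_elim simp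
      then show "\<omega> \<in> B" by (simp add: eventually_const ae_filter_eq_bot_iff)
    qed
    with elim(2) show ?case by simp
  qed
  have C: "C \<in> sets m"
  proof -
    define N where "N = {p \<in> space (m \<Otimes>\<^sub>M lborel). \<sigma> (snd p) (fst p) \<notin> B}"
    have N: "N \<in> sets (m \<Otimes>\<^sub>M lborel)" unfolding N_def by measurable
    have "(AE t in lborel. \<sigma> t \<omega> \<in> B) \<longleftrightarrow> emeasure lborel (Pair \<omega> -` N) = 0" for \<omega>
      using sets_Pair1[OF N, of \<omega>]
      by (intro AE_iff_measurable) (auto simp: N_def space_m space_pair_measure)
    then have "C = {\<omega> \<in> space m. emeasure lborel (Pair \<omega> -` N) = 0}"
      by (auto simp: C_def space_m)
    also have "\<dots> \<in> sets m" using lborel.measurable_emeasure_Pair[OF N] by measurable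
    finally show ?thesis .
  qed
  have shift: "\<sigma> s \<omega> \<in> C" if "\<omega> \<in> C" for s \<omega>
  proof -
    have "AE t in distr lborel borel ((+) s). \<sigma> t \<omega> \<in> B"
      unfolding lborel_distr_plus using that by (simp add: C_def)
    then have "AE t in lborel. \<sigma> (s + t) \<omega> \<in> B" by (rule AE_distrD[rotated]) simp
    then show ?thesis by (simp add: C_def add.commute flip: flow_add)
  qed
  have "\<sigma> t ` C = C" for t
    using shift[of _ "- t"] shift[of _ t] unfolding flow_image_eq_vimage
    by (auto simp: flow_0 simp flip: flow_add dest: shift[of "\<sigma> (- t) _" t])
  with m C have "emeasure m C = 0 \<or> emeasure m C = 1"
    by (auto simp: erg_measures_def sets_m)
  then have "(AE \<omega> in m. \<omega> \<notin> C) \<or> (AE \<omega> in m. \<omega> \<in> C)"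
    using C AE_iff_measurable[of C m "\<lambda>\<omega>. \<omega> \<notin> C"] prob_eq_1[OF C]
    by (auto simp: space_m emeasure_eq_measure)
  then show ?thesis
  proof
    assume "AE \<omega> in m. \<omega> \<notin> C"
    with AC have "AE \<omega> in m. \<omega> \<notin> A" by eventually_elim simp
    then show ?thesis ..
  next
    assume "AE \<omega> in m. \<omega> \<in> C"
    with AC have "AE \<omega> in m. \<omega> \<in> A" by eventually_elim simp
    then show ?thesis ..
  qed
qed

text \<open>
  The difference quotients of \<open>h\<close> along the flow are coboundaries of the time maps, hence have zero
  mean. They are bounded by \<open>L\<close> and converge to \<open>F\<close>, so \<open>F\<close> has zero mean by dominated
  convergence. Working with the times \<open>1/(n+1)\<close> keeps the exceptional null sets countable when
  \<open>h\<close> is replaced by a Borel representative.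
\<close>

lemma integral_flow_derivative_eq_0:
  fixes h F :: "'w \<Rightarrow> real"
  assumes h: "h \<in> borel_measurable (completion m)" and F: "F \<in> borel_measurable (completion m)"
    and bd: "\<And>t. AE \<omega> in m. \<bar>h (\<sigma> t \<omega>) - h \<omega>\<bar> \<le> L * \<bar>t\<bar>"
    and deriv: "AE \<omega> in m. ((\<lambda>t. h (\<sigma> t \<omega>)) has_real_derivative F \<omega>) (at 0)"
  shows "(\<integral>\<omega>. F \<omega> \<partial>completion m) = 0"
proof -
  interpret prob_space m by (rule prob_space_m)
  obtain h' where h'[measurable]: "h' \<in> borel_measurable m" and hh': "AE \<omega> in m. h \<omega> = h' \<omega>"
    using completion_ex_borel_measurable_real[OF h] by blast
  obtain F' where F'[measurable]: "F' \<in> borel_measurable m" and FF': "AE \<omega> in m. F \<omega> = F' \<omega>"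
    using completion_ex_borel_measurable_real[OF F] by blast
  note [measurable] = measurable_flow_space
  define t where "t n = 1 / real (Suc n)" for n
  have t: "t n > 0" for n by (simp add: t_def)
  have t0: "t \<longlonglongrightarrow> 0"
    unfolding t_def using LIMSEQ_inverse_real_of_nat by (simp add: inverse_eq_divide)
  define q where "q n \<omega> = (h' (\<sigma> (t n) \<omega>) - h' \<omega>) / t n" for n \<omega>
  have q[measurable]: "q n \<in> borel_measurable m" for n unfolding q_def by measurable
  have hq: "AE \<omega> in m. q n \<omega> = (h (\<sigma> (t n) \<omega>) - h \<omega>) / t n" for n
    using hh' AE_flow[OF hh', of "t n"] by eventually_elim (simp add: q_def)
  have bdq: "AE \<omega> in m. \<bar>q n \<omega>\<bar> \<le> L" for n
    using bd[of "t n"] hq[of n] by eventually_elim (use t[of n] in \<open>simp add: abs_divide divide_le_eq\<close>)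
  have "(\<integral>\<omega>. h' (\<sigma> (t n) \<omega>) - h' \<omega> \<partial>m) = 0" for n
  proof (rule integral_coboundary_eq_0)
    show "AE \<omega> in m. \<bar>h' (\<sigma> (t n) \<omega>) - h' \<omega>\<bar> \<le> L * t n"
      using bdq[of n] by eventually_elim (use t[of n] in \<open>simp add: q_def abs_divide divide_le_eq\<close>)
  qed (auto intro: finite_measure_axioms measurable_flow_space distr_flow)
  then have q0: "(\<integral>\<omega>. q n \<omega> \<partial>m) = 0" for n by (simp add: q_def)
  have "(\<lambda>n. \<integral>\<omega>. q n \<omega> \<partial>m) \<longlonglongrightarrow> (\<integral>\<omega>. F' \<omega> \<partial>m)"
  proof (rule integral_dominated_convergence[where w = "\<lambda>_. L"])
    have "AE \<omega> in m. \<forall>n. q n \<omega> = (h (\<sigma> (t n) \<omega>) - h \<omega>) / t n"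
      using hq by (simp add: AE_all_countable)
    then show "AE \<omega> in m. (\<lambda>n. q n \<omega>) \<longlonglongrightarrow> F' \<omega>"
      using deriv FF'
    proof eventually_elim
      case (elim \<omega>)
      have "((\<lambda>s. (h (\<sigma> s \<omega>) - h \<omega>) / s) \<longlongrightarrow> F \<omega>) (at 0)"
        using elim(2) by (simp add: has_field_derivative_iff flow_0)
      moreover have "filterlim t (at 0) sequentially"
        using t t0 by (intro filterlim_atI) (auto intro!: always_eventually simp: less_imp_neq[symmetric])
      ultimately have "(\<lambda>n. (h (\<sigma> (t n) \<omega>) - h \<omega>) / t n) \<longlonglongrightarrow> F \<omega>"
        by (rule filterlim_compose)
      with elim(1,3) show ?case by simp
    qed
  qed (use bdq in auto)
  then have "(\<integral>\<omega>. F' \<omega> \<partial>m) = 0" by (simp add: q0 LIMSEQ_const_iff)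
  moreover have "(\<integral>\<omega>. F \<omega> \<partial>completion m) = (\<integral>\<omega>. F' \<omega> \<partial>completion m)"
    by (rule integral_cong_AE) (use F FF' in \<open>auto intro: AE_completion measurable_completion\<close>)
  ultimately show ?thesis by (simp add: integral_completion)
qed

end

section \<open>Comparing the separation rate with the end-point derivatives\<close>

text \<open>
  Concavity makes every second difference nonnegative, so the infimum in \<open>b_fun\<close> is over a set
  bounded below, and its positivity bounds each second difference away from zero.
\<close>

lemma b_fun_pos_imp_strictly_concave:
  assumes conc: "concave_on UNIV (f_x f \<omega>)" and b: "0 < b_fun f {p..q} \<epsilon> \<omega>" and "0 < \<epsilon>"
    and x: "p \<le> x - \<epsilon> / 2" "x + \<epsilon> / 2 \<le> q"
  shows "f_x f \<omega> (x - \<epsilon> / 2) + f_x f \<omega> (x + \<epsilon> / 2) < 2 * f_x f \<omega> x"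
proof -
  define B where "B y = 2 * f_x f \<omega> y - f_x f \<omega> (y - \<epsilon> / 2) - f_x f \<omega> (y + \<epsilon> / 2)" for y
  have B0: "0 \<le> B y" for y
    using concave_onD[OF conc, of "1/2" "y - \<epsilon> / 2" "y + \<epsilon> / 2"] by (simp add: B_def field_simps)
  have "0 < \<epsilon> / (4 * (interval_length {p..q})\<^sup>2) * (INF y\<in>inner_interval {p..q} \<epsilon>. B y)"
    using b by (simp add: b_fun_def B_def)
  moreover have "0 \<le> \<epsilon> / (4 * (interval_length {p..q})\<^sup>2)" using \<open>0 < \<epsilon>\<close> by simp
  ultimately have "0 < (INF y\<in>inner_interval {p..q} \<epsilon>. B y)"
    by (simp only: zero_less_mult_iff) linarith
  also have "\<dots> \<le> B x"
    using x B0 by (intro cINF_lower bdd_belowI2[of _ 0]) (auto simp: inner_interval_def)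
  finally show ?thesis by (simp add: B_def)
qed

lemma difference_quotient_ge_mean:
  assumes f: "C0k 2 f" and "DC f" and ne: "x \<noteq> y"
  shows "f_x f \<omega> x + f_x f \<omega> y \<le> 2 * ((f \<omega> x - f \<omega> y) / (x - y))"
    and "\<lbrakk>0 < b_fun f {p..q} \<epsilon> \<omega>; 0 < \<epsilon>; \<epsilon> \<le> \<bar>x - y\<bar>; x \<in> {p..q}; y \<in> {p..q}\<rbrakk>
           \<Longrightarrow> f_x f \<omega> x + f_x f \<omega> y < 2 * ((f \<omega> x - f \<omega> y) / (x - y))"
proof -
  have conc: "concave_on UNIV (f_x f \<omega>)" using \<open>DC f\<close> by (simp add: DC_def)
  define quot where "quot x y = (f \<omega> x - f \<omega> y) / (x - y)" for x y
  have quot_commute: "quot x y = quot y x" for x y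
    using minus_divide_divide[of "f \<omega> x - f \<omega> y" "x - y"] by (simp add: quot_def)
  have weak: "f_x f \<omega> x + f_x f \<omega> y \<le> 2 * quot x y"
    and strict: "\<lbrakk>0 < b_fun f {p..q} \<epsilon> \<omega>; 0 < \<epsilon>; \<epsilon> \<le> \<bar>x - y\<bar>; x \<in> {p..q}; y \<in> {p..q}\<rbrakk>
           \<Longrightarrow> f_x f \<omega> x + f_x f \<omega> y < 2 * quot x y"
    if lt: "y < x" for x y
  proof -
    have cc: "concave_on {y..x} (f_x f \<omega>)"
      using conc by (auto simp: concave_on_iff)
    note hh = hermite_hadamard_concave[OF cc lt C0k_2_D(1)[OF f]]
    show "f_x f \<omega> x + f_x f \<omega> y \<le> 2 * quot x y"
      using hh(1) lt by (simp add: quot_def field_simps)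
    assume b: "0 < b_fun f {p..q} \<epsilon> \<omega>" and \<epsilon>: "0 < \<epsilon>" "\<epsilon> \<le> \<bar>x - y\<bar>"
      and J: "x \<in> {p..q}" "y \<in> {p..q}"
    \<comment> \<open>The second difference of step \<open>\<epsilon> / 2\<close> at the midpoint fits in \<open>[y, x]\<close>, as \<open>\<epsilon> \<le> x - y\<close>.\<close>
    define z where "z = (x + y) / 2"
    have z: "y \<le> z - \<epsilon> / 2" "z + \<epsilon> / 2 \<le> x"
      using \<epsilon> lt by (auto simp: z_def field_simps)
    with J have "p \<le> z - \<epsilon> / 2" "z + \<epsilon> / 2 \<le> q" by auto
    from b_fun_pos_imp_strictly_concave[OF conc b \<epsilon>(1) this] hh(2)[OF z] \<epsilon>(1) lt
    show "f_x f \<omega> x + f_x f \<omega> y < 2 * quot x y" by (simp add: quot_def field_simps)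
  qed
  show "f_x f \<omega> x + f_x f \<omega> y \<le> 2 * ((f \<omega> x - f \<omega> y) / (x - y))"
    using weak[of y x] weak[of x y] ne quot_commute[of x y]
    by (cases "y < x") (auto simp flip: quot_def)
  show "f_x f \<omega> x + f_x f \<omega> y < 2 * ((f \<omega> x - f \<omega> y) / (x - y))"
    if "0 < b_fun f {p..q} \<epsilon> \<omega>" "0 < \<epsilon>" "\<epsilon> \<le> \<bar>x - y\<bar>" "x \<in> {p..q}" "y \<in> {p..q}"
    using strict[of y x] strict[of x y] that ne quot_commute[of x y]
    by (cases "y < x") (auto simp flip: quot_def)
qed

section \<open>Graphs in compact sets\<close>

lemma graph_in_compact_bounds:
  assumes "compact K" and "graph_of \<beta> \<subseteq> K"
  shows "\<beta> \<omega> \<in> {Inf (snd ` K)..Sup (snd ` K)}"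
proof -
  have "bounded (snd ` K)"
    using assms(1) by (intro compact_imp_bounded compact_continuous_image continuous_intros)
  then have "bdd_below (snd ` K)" "bdd_above (snd ` K)"
    by (simp_all add: bounded_imp_bdd_below bounded_imp_bdd_above)
  moreover have "\<beta> \<omega> \<in> snd ` K"
    using assms(2) by (force simp: graph_of_def)
  ultimately show ?thesis by (auto intro: cInf_lower cSup_upper)
qed

lemma disjoint_compact_graphs_separated:
  fixes \<beta> \<gamma> :: "'w::metric_space \<Rightarrow> real"
  assumes "compact K\<^sub>1" and "compact K\<^sub>2" and "K\<^sub>1 \<inter> K\<^sub>2 = {}"
    and "graph_of \<beta> \<subseteq> K\<^sub>1" and "graph_of \<gamma> \<subseteq> K\<^sub>2"
  obtains \<delta> where "0 < \<delta>" and "\<And>\<omega>. \<delta> \<le> \<bar>\<beta> \<omega> - \<gamma> \<omega>\<bar>"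
proof -
  have "continuous_on (K\<^sub>1 \<times> K\<^sub>2) (\<lambda>p. dist (fst p) (snd p))"
    by (intro continuous_intros)
  moreover have "compact (K\<^sub>1 \<times> K\<^sub>2)" by (intro compact_Times assms(1,2))
  moreover have "K\<^sub>1 \<times> K\<^sub>2 \<noteq> {}" using assms(4,5) by (auto simp: graph_of_def)
  ultimately obtain a b where ab: "a \<in> K\<^sub>1" "b \<in> K\<^sub>2"
    and min: "\<And>x y. \<lbrakk>x \<in> K\<^sub>1; y \<in> K\<^sub>2\<rbrakk> \<Longrightarrow> dist a b \<le> dist x y"
    using continuous_attains_inf[of "K\<^sub>1 \<times> K\<^sub>2" "\<lambda>p. dist (fst p) (snd p)"] by fastforce
  define \<delta> where "\<delta> = dist a b"
  have "0 < \<delta>" using ab assms(3) by (auto simp: \<delta>_def)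
  have "\<delta> \<le> \<bar>\<beta> \<omega> - \<gamma> \<omega>\<bar>" for \<omega>
  proof -
    have "(\<omega>, \<beta> \<omega>) \<in> K\<^sub>1" "(\<omega>, \<gamma> \<omega>) \<in> K\<^sub>2" using assms(4,5) by (auto simp: graph_of_def)
    then have "\<delta> \<le> dist (\<omega>, \<beta> \<omega>) (\<omega>, \<gamma> \<omega>)" unfolding \<delta>_def by (rule min)
    then show ?thesis by (simp add: dist_Pair_Pair dist_real_def)
  qed
  with \<open>0 < \<delta>\<close> show ?thesis by (rule that)
qed

section \<open>The sum of the Lyapunov exponents of two equilibria\<close>

theorem proposition4p4:
  fixes \<sigma> :: "real \<Rightarrow> 'w::metric_space \<Rightarrow> 'w"
    and f :: "'w \<Rightarrow> real \<Rightarrow> real"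
    and m :: "'w measure"
    and K :: "('w \<times> real) set"
    and \<beta>\<^sub>\<nu> \<beta>\<^sub>\<mu> :: "'w \<Rightarrow> real"
  assumes "compact (UNIV :: 'w set)"
    and "continuous_flow \<sigma>"
    and "C0k 2 f"
    and "DC f"
    and "m \<in> erg_measures \<sigma>"
    and "compact K" and "tau_invariant \<sigma> f K" and "fst ` K = UNIV"
    and "\<beta>\<^sub>\<nu> \<in> borel_measurable (completion m)" and "tau_equilibrium \<sigma> f \<beta>\<^sub>\<nu>"
    and "graph_of \<beta>\<^sub>\<nu> \<subseteq> K"
    and "\<beta>\<^sub>\<mu> \<in> borel_measurable (completion m)" and "tau_equilibrium \<sigma> f \<beta>\<^sub>\<mu>"
    and "graph_of \<beta>\<^sub>\<mu> \<subseteq> K"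
    and "\<not> (AE \<omega> in m. \<beta>\<^sub>\<nu> \<omega> = \<beta>\<^sub>\<mu> \<omega>)"
  shows "(LINT \<omega>|completion m. f_x f \<omega> (\<beta>\<^sub>\<nu> \<omega>)) + (LINT \<omega>|completion m. f_x f \<omega> (\<beta>\<^sub>\<mu> \<omega>)) \<le> 0 \<and>
    (SDC_wrt m f (variation_interval K) \<or>
     ((\<exists>K\<^sub>1 K\<^sub>2. compact K\<^sub>1 \<and> tau_invariant \<sigma> f K\<^sub>1 \<and> K\<^sub>1 \<subseteq> K \<and> graph_of \<beta>\<^sub>\<nu> \<subseteq> K\<^sub>1 \<and>
               compact K\<^sub>2 \<and> tau_invariant \<sigma> f K\<^sub>2 \<and> K\<^sub>2 \<subseteq> K \<and> graph_of \<beta>\<^sub>\<mu> \<subseteq> K\<^sub>2 \<and>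
               K\<^sub>1 \<inter> K\<^sub>2 = {}) \<and>
      (SDC \<sigma> f \<or>
       (\<forall>\<epsilon>\<in>{0<..interval_length (variation_interval K) / 2}.
          measure m {\<omega>. b_fun f (variation_interval K) \<epsilon> \<omega> > 0} > 0)))
     \<longrightarrow> (LINT \<omega>|completion m. f_x f \<omega> (\<beta>\<^sub>\<nu> \<omega>)) + (LINT \<omega>|completion m. f_x f \<omega> (\<beta>\<^sub>\<mu> \<omega>)) < 0)"
proof -
  note cpt = assms(1) and flow = assms(2) and f = assms(3) and m = assms(5)
  note \<nu>[measurable] = assms(9) and \<mu>[measurable] = assms(12)
  let ?M = "completion m"
  let ?d = "\<lambda>\<omega>. \<bar>\<beta>\<^sub>\<nu> \<omega> - \<beta>\<^sub>\<mu> \<omega>\<bar>"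
  define rate where "rate = separation_rate f \<beta>\<^sub>\<nu> \<beta>\<^sub>\<mu>"
  interpret m: prob_space m by (rule prob_space_m[OF flow m])
  interpret M: prob_space ?M by (rule m.prob_space_completion)
  have sets_m: "sets m = sets borel" by (rule sets_m[OF flow m])
  have space_m: "space m = UNIV" by (rule space_m[OF flow m])

  define p q where "p = Inf (snd ` K)" and "q = Sup (snd ` K)"
  have J: "variation_interval K = {p..q}" by (simp add: variation_interval_def p_def q_def)
  have \<nu>J: "\<beta>\<^sub>\<nu> \<omega> \<in> {p..q}" and \<mu>J: "\<beta>\<^sub>\<mu> \<omega> \<in> {p..q}" for \<omega>
    unfolding p_def q_def using assms(6,11,14) by (blast intro: graph_in_compact_bounds)+
  obtain \<omega>\<^sub>0 where "\<beta>\<^sub>\<nu> \<omega>\<^sub>0 \<noteq> \<beta>\<^sub>\<mu> \<omega>\<^sub>0" using assms(15) by fastforce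
  with \<nu>J[of \<omega>\<^sub>0] \<mu>J[of \<omega>\<^sub>0] have pq: "p < q" by auto
  then have len: "interval_length {p..q} = q - p" by (simp add: interval_length_def)

  obtain L where L: "\<And>\<omega> x. \<bar>x\<bar> \<le> max \<bar>p\<bar> \<bar>q\<bar> \<Longrightarrow> \<bar>f_x f \<omega> x\<bar> \<le> L"
    "\<And>\<omega> x y. \<lbrakk>\<bar>x\<bar> \<le> max \<bar>p\<bar> \<bar>q\<bar>; \<bar>y\<bar> \<le> max \<bar>p\<bar> \<bar>q\<bar>\<rbrakk> \<Longrightarrow> \<bar>f \<omega> x - f \<omega> y\<bar> \<le> L * \<bar>x - y\<bar>"
    and L0: "0 \<le> L"
    using C0k_2_lipschitz[OF cpt f, of "max \<bar>p\<bar> \<bar>q\<bar>"] by metis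
  have R: "\<bar>\<beta>\<^sub>\<nu> \<omega>\<bar> \<le> max \<bar>p\<bar> \<bar>q\<bar>" "\<bar>\<beta>\<^sub>\<mu> \<omega>\<bar> \<le> max \<bar>p\<bar> \<bar>q\<bar>" for \<omega>
    using \<nu>J[of \<omega>] \<mu>J[of \<omega>] by auto
  have lip: "\<bar>f \<omega> (\<beta>\<^sub>\<nu> \<omega>) - f \<omega> (\<beta>\<^sub>\<mu> \<omega>)\<bar> \<le> L * ?d \<omega>" for \<omega>
    using L(2) R by blast

  have meas: "(\<lambda>\<omega>. F \<omega> (\<beta> \<omega>)) \<in> borel_measurable ?M"
    if "continuous_on UNIV (\<lambda>(\<omega>, x). F \<omega> x)" and "\<beta> \<in> borel_measurable ?M"
    for F :: "'w \<Rightarrow> real \<Rightarrow> real" and \<beta>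
  proof (rule borel_measurable_compose_parameter[of "\<lambda>x \<omega>. F \<omega> x"])
    show "(\<lambda>\<omega>. F \<omega> x) \<in> borel_measurable ?M" for x
    proof -
      have "continuous_on UNIV (\<lambda>\<omega>. F \<omega> x)"
        using continuous_on_compose2[OF that(1), of UNIV "\<lambda>\<omega>. (\<omega>, x)"]
        by (simp add: continuous_on_Pair)
      then have "(\<lambda>\<omega>. F \<omega> x) \<in> borel_measurable m"
        by (simp add: borel_measurable_continuous_onI measurable_cong_sets[OF sets_m refl])
      then show ?thesis by (rule measurable_completion)
    qed
    show "continuous_on UNIV (\<lambda>x. F \<omega> x)" for \<omega>
      using continuous_on_compose2[OF that(1), of UNIV "\<lambda>x. (\<omega>, x)"]
      by (simp add: continuous_on_Pair)
  qed fact
  note [measurable] = meas[OF C0k_2_D(2)[OF f] \<nu>] meas[OF C0k_2_D(2)[OF f] \<mu>]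
    meas[OF C0k_2_D(3)[OF f] \<nu>] meas[OF C0k_2_D(3)[OF f] \<mu>]
  have rate_meas[measurable]: "rate \<in> borel_measurable ?M"
    unfolding rate_def separation_rate_def[abs_def] by measurable

  \<comment> \<open>Ergodicity upgrades a set of points of difference that is not null to one of full measure.\<close>
  have ne: "AE \<omega> in m. \<beta>\<^sub>\<nu> \<omega> \<noteq> \<beta>\<^sub>\<mu> \<omega>"
  proof -
    define A where "A = {\<omega> \<in> space ?M. \<beta>\<^sub>\<nu> \<omega> \<noteq> \<beta>\<^sub>\<mu> \<omega>}"
    have "A \<in> sets ?M" unfolding A_def by measurable
    moreover have "\<sigma> t \<omega> \<in> A \<longleftrightarrow> \<omega> \<in> A" for t \<omega>
      using equilibria_meet_invariant[OF cpt flow f assms(10,13) lip] by (simp add: A_def space_m)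
    ultimately have "(AE \<omega> in m. \<omega> \<in> A) \<or> (AE \<omega> in m. \<omega> \<notin> A)"
      by (rule ergodic_invariant_set_completion[OF flow m])
    with assms(15) show ?thesis by (simp add: A_def space_m)
  qed

  have rate0: "(\<integral>\<omega>. rate \<omega> \<partial>?M) = 0"
  proof (rule integral_flow_derivative_eq_0[OF flow m, of "\<lambda>\<omega>. ln (?d \<omega>)"])
    show "AE \<omega> in m. \<bar>ln (?d (\<sigma> t \<omega>)) - ln (?d \<omega>)\<bar> \<le> L * \<bar>t\<bar>" for t
      using ne by eventually_elim (rule ln_separation_lipschitz[OF cpt flow f assms(10,13) lip])
    show "AE \<omega> in m. ((\<lambda>t. ln (?d (\<sigma> t \<omega>))) has_real_derivative rate \<omega>) (at 0)"
      using ne unfolding rate_def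
      by eventually_elim (rule ln_separation_has_derivative[OF cpt flow f assms(10,13) lip])
  qed (use rate_meas in measurable)

  have rate_bd: "\<bar>rate \<omega>\<bar> \<le> L" for \<omega>
    using lip[of \<omega>] L0 by (simp add: rate_def separation_rate_def abs_divide divide_le_eq)
  have int: "integrable ?M rate" "integrable ?M (\<lambda>\<omega>. f_x f \<omega> (\<beta>\<^sub>\<nu> \<omega>))"
    "integrable ?M (\<lambda>\<omega>. f_x f \<omega> (\<beta>\<^sub>\<mu> \<omega>))"
    using rate_bd L(1) R by (auto intro!: M.integrable_const_bound[where B = L])

  \<comment> \<open>The Hermite--Hadamard defect, whose integral is minus the sum in question.\<close>
  define g where "g \<omega> = 2 * rate \<omega> - f_x f \<omega> (\<beta>\<^sub>\<nu> \<omega>) - f_x f \<omega> (\<beta>\<^sub>\<mu> \<omega>)" for \<omega>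
  have g_int: "integrable ?M g" unfolding g_def using int by simp
  have g_eq: "(\<integral>\<omega>. g \<omega> \<partial>?M) =
      - ((\<integral>\<omega>. f_x f \<omega> (\<beta>\<^sub>\<nu> \<omega>) \<partial>?M) + (\<integral>\<omega>. f_x f \<omega> (\<beta>\<^sub>\<mu> \<omega>) \<partial>?M))"
    unfolding g_def using int rate0 by simp
  have g_nonneg: "AE \<omega> in ?M. 0 \<le> g \<omega>"
    using AE_completion[OF ne]
  proof eventually_elim
    case (elim \<omega>)
    from difference_quotient_ge_mean(1)[OF f assms(4) this, of \<omega>]
    show ?case by (simp add: g_def rate_def separation_rate_def)
  qed
  have le: "0 \<le> (\<integral>\<omega>. g \<omega> \<partial>?M)" using g_nonneg by (rule integral_nonneg_AE)

  \<comment> \<open>In case of equality, \<open>f_x f \<omega>\<close> is affine between the equilibria for almost every \<open>\<omega>\<close>, so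
    positivity of \<open>b_fun\<close> at scale \<open>\<epsilon>\<close> forces the equilibria to be closer than \<open>\<epsilon>\<close>.\<close>
  have small: "measure m {\<omega>. b_fun f {p..q} \<epsilon> \<omega> > 0} \<le> measure ?M {\<omega> \<in> space ?M. ?d \<omega> < \<epsilon>}"
    if eq: "(\<integral>\<omega>. g \<omega> \<partial>?M) = 0" and \<epsilon>: "0 < \<epsilon>" for \<epsilon>
  proof (cases "{\<omega>. b_fun f {p..q} \<epsilon> \<omega> > 0} \<in> sets m")
    case True
    have "AE \<omega> in ?M. g \<omega> = 0"
      using eq integral_nonneg_eq_0_iff_AE[OF g_int g_nonneg] by simp
    then have "AE \<omega> in ?M. \<omega> \<in> {\<omega>. b_fun f {p..q} \<epsilon> \<omega> > 0} \<longrightarrow> \<omega> \<in> {\<omega> \<in> space ?M. ?d \<omega> < \<epsilon>}"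
      using AE_completion[OF ne]
    proof eventually_elim
      case (elim \<omega>)
      with difference_quotient_ge_mean(2)[OF f assms(4) elim(2), of p q \<epsilon> \<omega>] \<epsilon> \<nu>J[of \<omega>] \<mu>J[of \<omega>]
      show ?case by (force simp: g_def rate_def separation_rate_def space_m)
    qed
    then have "measure ?M {\<omega>. b_fun f {p..q} \<epsilon> \<omega> > 0} \<le> measure ?M {\<omega> \<in> space ?M. ?d \<omega> < \<epsilon>}"
      by (rule M.finite_measure_mono_AE) measurable
    with True show ?thesis by simp
  next
    case False
    \<comment> \<open>A set outside the \<open>\<sigma>\<close>-algebra is assigned measure \<open>0\<close>.\<close>
    then show ?thesis by (simp add: measure_notin_sets)
  qed

  \<comment> \<open>The lower bound \<open>\<rho>\<close> is uniform in \<open>\<epsilon>\<close>, but the set where the equilibria are \<open>\<epsilon>\<close>-close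
    shrinks to a null set.\<close>
  have nz1: "(\<integral>\<omega>. g \<omega> \<partial>?M) \<noteq> 0" if SDC: "SDC_wrt m f {p..q}"
  proof
    assume eq: "(\<integral>\<omega>. g \<omega> \<partial>?M) = 0"
    obtain \<rho> where \<rho>: "0 < \<rho>"
      "\<And>\<epsilon>. \<epsilon> \<in> {0<..(q - p) / 2} \<Longrightarrow> \<rho> < measure m {\<omega>. b_fun f {p..q} \<epsilon> \<omega> > 0}"
      using SDC unfolding SDC_wrt_def len by blast
    define S where "S n = {\<omega> \<in> space ?M. ?d \<omega> < 1 / real (Suc n)}" for n
    have "(\<lambda>n. measure ?M (S n)) \<longlonglongrightarrow> measure ?M (\<Inter>n. S n)"
    proof (rule M.finite_Lim_measure_decseq)
      have "S n \<in> sets ?M" for n unfolding S_def by measurable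
      then show "range S \<subseteq> sets ?M" by blast
      have "1 / real (Suc n) \<le> 1 / real (Suc k)" if "k \<le> n" for k n
        using that by (intro divide_left_mono) auto
      then show "decseq S" by (fastforce simp: decseq_def S_def)
    qed
    also have "measure ?M (\<Inter>n. S n) = 0"
    proof -
      have "AE \<omega> in ?M. \<omega> \<notin> (\<Inter>n. S n)"
        using AE_completion[OF ne]
      proof eventually_elim
        case (elim \<omega>)
        then have "0 < ?d \<omega>" by simp
        then obtain n where "1 / real (Suc n) < ?d \<omega>" by (metis nat_approx_posE)
        then show ?case by (auto simp: S_def intro!: exI[of _ n])
      qed
      moreover have "(\<Inter>n. S n) \<in> sets ?M" unfolding S_def by measurable
      ultimately show ?thesis by (simp add: M.prob_eq_0)
    qed
    finally have "\<forall>\<^sub>F n in sequentially. measure ?M (S n) < \<rho>"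
      using \<open>0 < \<rho>\<close> by (rule order_tendstoD)
    moreover have "\<forall>\<^sub>F n in sequentially. 1 / real (Suc n) < (q - p) / 2"
      using pq LIMSEQ_inverse_real_of_nat by (intro order_tendstoD) (auto simp: inverse_eq_divide)
    ultimately have "\<forall>\<^sub>F n in sequentially. False"
    proof eventually_elim
      case (elim n)
      with \<rho>(2)[of "1 / real (Suc n)"] small[OF eq, of "1 / real (Suc n)"]
      show ?case by (simp add: S_def)
    qed
    then show False by simp
  qed

  \<comment> \<open>Here the equilibria are nowhere \<open>\<epsilon>\<close>-close for small \<open>\<epsilon>\<close>, so one scale \<open>\<epsilon>\<close> suffices.\<close>
  have nz2: "(\<integral>\<omega>. g \<omega> \<partial>?M) \<noteq> 0"
    if K: "compact K\<^sub>1" "compact K\<^sub>2" "K\<^sub>1 \<inter> K\<^sub>2 = {}" "graph_of \<beta>\<^sub>\<nu> \<subseteq> K\<^sub>1" "graph_of \<beta>\<^sub>\<mu> \<subseteq> K\<^sub>2"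
      and b: "SDC \<sigma> f \<or> (\<forall>\<epsilon>\<in>{0<..(q - p) / 2}. measure m {\<omega>. b_fun f {p..q} \<epsilon> \<omega> > 0} > 0)"
    for K\<^sub>1 K\<^sub>2
  proof
    assume eq: "(\<integral>\<omega>. g \<omega> \<partial>?M) = 0"
    obtain \<delta> where \<delta>: "0 < \<delta>" "\<And>\<omega>. \<delta> \<le> ?d \<omega>"
      using disjoint_compact_graphs_separated[OF K] by blast
    define \<epsilon> where "\<epsilon> = min \<delta> ((q - p) / 2)"
    have \<epsilon>: "0 < \<epsilon>" "\<epsilon> \<in> {0<..(q - p) / 2}" "\<epsilon> \<le> \<delta>" using \<delta>(1) pq by (auto simp: \<epsilon>_def min_def)
    have "\<forall>\<epsilon>\<in>{0<..(q - p) / 2}. measure m {\<omega>. b_fun f {p..q} \<epsilon> \<omega> > 0} > 0"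
      using b m pq len unfolding SDC_def SDC_on_def by metis
    with \<epsilon> have "0 < measure m {\<omega>. b_fun f {p..q} \<epsilon> \<omega> > 0}" by blast
    moreover have "\<not> ?d \<omega> < \<epsilon>" for \<omega> using \<delta>(2)[of \<omega>] \<epsilon>(3) by simp
    then have "{\<omega> \<in> space ?M. ?d \<omega> < \<epsilon>} = {}" by blast
    ultimately show False using small[OF eq \<epsilon>(1)] by (simp only: measure_empty)
  qed

  show ?thesis (is "?sum \<le> 0 \<and> (?cases \<longrightarrow> ?sum < 0)")
  proof (intro conjI impI)
    show "?sum \<le> 0" using le g_eq by linarith
    assume ?cases
    then show "?sum < 0"
      unfolding J len
    proof (elim disjE[of "SDC_wrt m f {p..q}"] conjE exE)
      assume "SDC_wrt m f {p..q}"
      from nz1[OF this] le g_eq show ?thesis by linarith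
    next
      fix K\<^sub>1 K\<^sub>2
      assume "compact K\<^sub>1" "compact K\<^sub>2" "K\<^sub>1 \<inter> K\<^sub>2 = {}" "graph_of \<beta>\<^sub>\<nu> \<subseteq> K\<^sub>1" "graph_of \<beta>\<^sub>\<mu> \<subseteq> K\<^sub>2"
        and "SDC \<sigma> f \<or> (\<forall>\<epsilon>\<in>{0<..(q - p) / 2}. 0 < measure m {\<omega>. 0 < b_fun f {p..q} \<epsilon> \<omega>})"
      from nz2[OF this] le g_eq show ?thesis by linarith
    qed
  qed
qed

end
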